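(* Let $(B,\varphi)$ be a non-commutative probability space over $\mathbb C$ and $(b_n)_{n\in\mathbb N}$ a countable family of elements of $B$. Let $\Phi\in\mathcal G(\mathbb C)$ be the associated moment character, $\Phi^{-1}$ its inverse in the convolution group $\mathcal G(\mathbb C)$, and let $\kappa,\beta\in\mathcal L(\mathbb C)$ be the infinitesimal characters defined by $\Phi=\varepsilon_{\mathbb C}+\kappa\prec\Phi$ and $\Phi=\varepsilon_{\mathbb C}+\Phi\succ\beta$. Then, in $\mathbb C\langle\langle x_1,x_2,x_3,\dots\rangle\rangle$: (i) for the multivariate generating series of free cumulants $\widehat\kappa(x)$, $$\widehat{\Phi^{-1}}(x)=\frac{1}{1+\widehat\kappa(x)};$$ (ii) for the multivariate generating series of Boolean cumulants $\widehat\beta(x)$, $$\widehat\beta(x)=1-\widehat{\Phi^{-1}}\big(x\,\widehat\Phi(x)\big).$$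
   Context: A non-commutative probability space $(B,\varphi)$ over $\mathbb C$ is an associative unital $\mathbb C$-algebra $B$ with a linear form $\varphi:B\to\mathbb C$, $\varphi(1_B)=1$. $\mathbb N=\{1,2,\dots\}$, $\mathbb N^*$ is the set of non-empty finite words over $\mathbb N$, $\mathbf 1$ the empty word. $V$ is the $\mathbb C$-vector space with basis $\mathbb N^*$, $T(V)=\bigoplus_{n\ge0}V^{\otimes n}$ is its tensor algebra with unit $\mathbf 1$ (identified with the empty word) and product written with bars, and $T_+(V)=\bigoplus_{n\ge1}V^{\otimes n}$. For $w=a_1\cdots a_n\in\mathbb N^*$ and $S\subseteq[n]$ let $w_S$ be the subword on positions in $S$ ($w_\varnothing=\mathbf 1$), and $J_1^S,\dots,J_m^S$ the maximal intervals of consecutive integers of $[n]\setminus S$, in increasing order. The coproduct is the algebra morphism $\Delta:T(V)\to T(V)\otimes T(V)$ with $\Delta(w)=\sum_{S\subseteq[n]}w_S\otimes w_{J_1^S}|\cdots|w_{J_m^S}$; with it $T(V)$ is a graded connected Hopf algebra. On $T_+(V)$, $\Delta=\Delta_\prec+\Delta_\succ$ with $$\Delta_\prec(w)=w\otimes\mathbf 1+\sum_{1\in S\subsetneq[n]}w_S\otimes w_{J_1^S}|\cdots|w_{J_m^S},\qquad \Delta_\succ(w)=\mathbf 1\otimes w+\sum_{1\notin S\subsetneq[n],\,S\ne\varnothing}w_S\otimes w_{J_1^S}|\cdots|w_{J_m^S},$$ and $\Delta_\prec(w_1|\cdots|w_n)=\Delta_\prec(w_1)\Delta(w_2|\cdots|w_n)$,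 similarly for $\Delta_\succ$. $\mathcal G(\mathbb C)$ is the set of unital algebra morphisms $T(V)\to\mathbb C$, a group under convolution $\phi\ast\psi=m_{\mathbb C}(\phi\otimes\psi)\Delta$ ($m_{\mathbb C}$ the product of $\mathbb C$), with unit the counit $\varepsilon_{\mathbb C}$ (equal to $1$ on $\mathbf 1$ and $0$ on $T_+(V)$). $\mathcal L(\mathbb C)$ is the set of linear maps $T(V)\to\mathbb C$ vanishing on $\mathbf 1$ and on $\bigoplus_{n\ge2}V^{\otimes n}$. The half-shuffle products are, on $T_+(V)$, $\phi\prec\psi=m_{\mathbb C}(\phi\otimes\psi)\Delta_\prec$ and $\phi\succ\psi=m_{\mathbb C}(\phi\otimes\psi)\Delta_\succ$, with value $0$ on $\mathbf 1$; they are used here for $\kappa\prec\Phi$ and $\Phi\succ\beta$, with $\kappa,\beta$ vanishing on $\mathbf 1$. The moment character is defined by $\Phi(i_1\cdots i_k)=\varphi(b_{i_1}\cdots b_{i_k})$ for $i_1\cdots i_k\in\mathbb N^*$ (product in $B$) and $\Phi(w_1|\cdots|w_p)=\Phi(w_1)\cdots\Phi(w_p)$. It is known that the fixed point equations determine unique $\kappa,\beta\in\mathcal L(\mathbb C)$, whose values on words are respectively the multivariate free and Boolean cumulants of $(b_n)$. For a linear form $\mu:T(V)\to\mathbb C$, $\widehat\mu(x)=\mu(\mathbf 1)+\sum_{w\in\mathbb N^*}\mu(w)x_w$, where $x_w=x_{i_1}\cdots x_{i_m}$ for $w=i_1\cdots i_m$ (non-commuting variables). $\widehat\mu(x\widehat\Phi(x))$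 is obtained from $\widehat\mu$ by substituting $x_i\widehat\Phi(x)$ for each $x_i$, and $1/h$ denotes the inverse of a series $h$ with constant term $1$ for the usual (Cauchy) product. *)

theory Defs
  imports Complex_Main "HOL-Library.Poly_Mapping" "HOL-Library.Product_Plus" "HOL-Algebra.Group"
begin

section \<open>Non-commutative probability spaces\<close>

locale nc_prob_space = vector_space scale
  for scale :: "complex \<Rightarrow> 'b::ring_1 \<Rightarrow> 'b" +
  fixes \<phi> :: "'b \<Rightarrow> complex"
  assumes scale_mult_left: "scale c x * y = scale c (x * y)"
    and scale_mult_right: "x * scale c y = scale c (x * y)"
    and linear_state: "Vector_Spaces.linear scale (*) \<phi>"
    and state_one: "\<phi> 1 = 1"


section \<open>The double tensor algebra\<close>

text \<open>
  The countable alphabet is \<^typ>\<open>nat\<close> (so the letters are numbered from 0).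
  A barred word \<open>w\<^sub>1|\<dots>|w\<^sub>n\<close> is a list of non-empty words; \<open>bar\<close> deletes empty
  words, which implements the identification of the empty word with the unit of \<open>T(V)\<close>.
\<close>

typedef barword = "{ws :: nat list list. [] \<notin> set ws}"
  morphisms words_of Abs_barword
  by (rule exI[of _ "[]"]) simp

definition bar :: "nat list list \<Rightarrow> barword" where
  "bar ws = Abs_barword (filter (\<lambda>w. w \<noteq> []) ws)"

lemma words_of_bar: "words_of (bar ws) = filter (\<lambda>w. w \<noteq> []) ws"
  unfolding bar_def by (rule Abs_barword_inverse) simp

lemma bar_words_of: "bar (words_of u) = u"
proof -
  have "filter (\<lambda>w. w \<noteq> []) (words_of u) = words_of u"
    using words_of[of u] by (auto intro!: filter_True)
  then show ?thesis
    by (simp add: bar_def words_of_inverse)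
qed

instantiation barword :: monoid_add
begin

definition zero_barword :: barword where
  "0 = bar []"

definition plus_barword :: "barword \<Rightarrow> barword \<Rightarrow> barword" where
  "u + v = bar (words_of u @ words_of v)"

instance
proof
  have words_plus: "words_of (a + b) = words_of a @ words_of b" for a b :: barword
    using words_of[of a] words_of[of b]
    unfolding plus_barword_def words_of_bar by (intro filter_True) auto
  fix a b c :: barword
  show "a + b + c = a + (b + c)"
    by (simp add: words_of_inject[symmetric] words_plus)
  show "0 + a = a" and "a + 0 = a"
    by (simp_all add: words_of_inject[symmetric] words_plus)
      (simp_all add: zero_barword_def words_of_bar)
qed

end

text \<open>
  Barred words form a basis of \<open>T(V)\<close>, and pairs of barred words a basis of
  \<open>T(V) \<otimes> T(V)\<close>. Multiplication of \<^type>\<open>poly_mapping\<close> is the bilinear extension of the addition of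
  keys, that is, of bar concatenation, respectively of componentwise bar concatenation.
\<close>

type_synonym TV = "barword \<Rightarrow>\<^sub>0 complex"
type_synonym TV2 = "(barword \<times> barword) \<Rightarrow>\<^sub>0 complex"

definition csmult :: "complex \<Rightarrow> ('k \<Rightarrow>\<^sub>0 complex) \<Rightarrow> ('k \<Rightarrow>\<^sub>0 complex)" where
  "csmult c = Poly_Mapping.map ((*) c)"

lemma lookup_csmult: "Poly_Mapping.lookup (csmult c p) u = c * Poly_Mapping.lookup p u"
  by (simp add: csmult_def Poly_Mapping.map.rep_eq when_def)

lemma vector_space_csmult: "vector_space (csmult :: complex \<Rightarrow> ('k \<Rightarrow>\<^sub>0 complex) \<Rightarrow> _)"
  by unfold_locales (auto intro!: poly_mapping_eqI simp: lookup_csmult lookup_add algebra_simps)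

definition basis :: "'k \<Rightarrow> ('k \<Rightarrow>\<^sub>0 complex)" where
  "basis u = Poly_Mapping.single u 1"

definition lin_ext :: "('k \<Rightarrow> ('l \<Rightarrow>\<^sub>0 complex)) \<Rightarrow> ('k \<Rightarrow>\<^sub>0 complex) \<Rightarrow> ('l \<Rightarrow>\<^sub>0 complex)" where
  "lin_ext f p = (\<Sum>u\<in>Poly_Mapping.keys p. csmult (Poly_Mapping.lookup p u) (f u))"

definition form_ext :: "('k \<Rightarrow> complex) \<Rightarrow> ('k \<Rightarrow>\<^sub>0 complex) \<Rightarrow> complex" where
  "form_ext f p = (\<Sum>u\<in>Poly_Mapping.keys p. Poly_Mapping.lookup p u * f u)"


section \<open>The coproduct and the half-coproducts\<close>

definition gaps :: "nat \<Rightarrow> nat set \<Rightarrow> nat set set" where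
  "gaps n S = {J. (\<exists>a b. a \<le> b \<and> J = {a..b}) \<and> J \<subseteq> {..<n} - S \<and>
      (\<forall>a b. J \<subseteq> {a..b} \<and> {a..b} \<subseteq> {..<n} - S \<longrightarrow> {a..b} = J)}"

definition before :: "nat set \<Rightarrow> nat set \<Rightarrow> bool" where
  "before J K \<longleftrightarrow> (\<forall>j\<in>J. \<forall>k\<in>K. j < k)"

text \<open>The list \<open>J\<^sub>1, \<dots>, J\<^sub>m\<close> of the gaps in increasing order.\<close>

definition gap_list :: "nat \<Rightarrow> nat set \<Rightarrow> nat set list" where
  "gap_list n S = (THE Js. set Js = gaps n S \<and> sorted_wrt before Js)"

lemma gaps_overlap:
  assumes J: "J \<in> gaps n S" and K: "K \<in> gaps n S" and le: "Min J \<le> Min K" and ne: "J \<noteq> K"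
  shows "before J K"
proof -
  obtain a b where ab: "a \<le> b" "J = {a..b}" using J by (auto simp: gaps_def)
  obtain c d where cd: "c \<le> d" "K = {c..d}" using K by (auto simp: gaps_def)
  have "Min {x..y} = x" if "x \<le> y" for x y :: nat
    using that by (intro Min_eqI) auto
  then have ac: "a \<le> c" using le ab cd by simp
  have "b < c"
  proof (rule ccontr)
    assume "\<not> b < c"
    then have un: "{a..max b d} = J \<union> K" using ab cd ac by auto
    then have sub: "{a..max b d} \<subseteq> {..<n} - S" using J K by (auto simp: gaps_def)
    have "{a..max b d} = J" using J sub un unfolding gaps_def by blast
    moreover have "{a..max b d} = K" using K sub un unfolding gaps_def by blast
    ultimately show False using ne by simp
  qed
  then show ?thesis by (auto simp: before_def ab cd)
qed

lemma ex1_gap_list: "\<exists>!Js. set Js = gaps n S \<and> sorted_wrt before Js"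
proof -
  have fin: "finite (gaps n S)"
    by (rule finite_subset[of _ "Pow {..<n}"]) (auto simp: gaps_def)
  have ne: "finite J \<and> J \<noteq> {}" if "J \<in> gaps n S" for J
    using that by (auto simp: gaps_def)
  have less: "Min J < Min K" if "J \<in> gaps n S" "K \<in> gaps n S" "before J K" for J K
    using that ne[of J] ne[of K] by (simp add: before_def)
  have inj: "inj_on Min (gaps n S)"
  proof (rule inj_onI, rule ccontr)
    fix J K assume JK: "J \<in> gaps n S" "K \<in> gaps n S" "Min J = Min K" "J \<noteq> K"
    then have "before J K" by (intro gaps_overlap) auto
    then show False using less[of J K] JK by simp
  qed
  let ?f = "the_inv_into (gaps n S) Min"
  define Js where "Js = map ?f (sorted_list_of_set (Min ` gaps n S))"
  have "set Js = gaps n S"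
    using fin inj by (simp add: Js_def the_inv_into_onto)
  moreover have "sorted_wrt before Js"
  proof -
    have "sorted_wrt (<) (sorted_list_of_set (Min ` gaps n S))"
      by (rule strict_sorted_list_of_set)
    moreover have "before (?f x) (?f y)"
      if xy: "x \<in> Min ` gaps n S" "y \<in> Min ` gaps n S" "x < y" for x y
    proof (rule gaps_overlap)
      show "?f x \<in> gaps n S" "?f y \<in> gaps n S"
        using xy inj by (auto intro: the_inv_into_into)
      have "Min (?f x) = x" "Min (?f y) = y"
        using xy inj by (auto intro: f_the_inv_into_f)
      then show "Min (?f x) \<le> Min (?f y)" "?f x \<noteq> ?f y" using xy by auto
    qed
    ultimately show ?thesis
      unfolding Js_def sorted_wrt_map using fin
      by (elim sorted_wrt_mono_rel[rotated]) auto
  qed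
  moreover have "Ks = Ls"
    if K: "set Ks = gaps n S" "sorted_wrt before Ks" and L: "set Ls = gaps n S" "sorted_wrt before Ls"
    for Ks Ls
  proof -
    have *: "sorted_wrt (<) (map Min Ms)" if "set Ms = gaps n S" "sorted_wrt before Ms" for Ms
      unfolding sorted_wrt_map using that by (auto intro: sorted_wrt_mono_rel[rotated] less)
    have "map Min Ks = map Min Ls"
      by (rule strict_sorted_equal) (use * K L in auto)
    then show ?thesis
      using inj K L by (auto intro: map_inj_on)
  qed
  ultimately show ?thesis by blast
qed

text \<open>Positions in a word are numbered from 0, so \<open>{..<length w}\<close> plays the role of \<open>[n]\<close>
  and the condition \<open>1 \<in> S\<close> becomes \<open>0 \<in> S\<close>.\<close>

definition split_term :: "nat list \<Rightarrow> nat set \<Rightarrow> TV2" where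
  "split_term w S =
     basis (bar [nths w S], bar (map (nths w) (gap_list (length w) S)))"

definition coprod_word :: "nat list \<Rightarrow> TV2" where
  "coprod_word w = (\<Sum>S\<in>Pow {..<length w}. split_term w S)"

definition coprod_prec_word :: "nat list \<Rightarrow> TV2" where
  "coprod_prec_word w = basis (bar [w], 0) +
     (\<Sum>S\<in>{S. S \<subset> {..<length w} \<and> 0 \<in> S}. split_term w S)"

definition coprod_succ_word :: "nat list \<Rightarrow> TV2" where
  "coprod_succ_word w = basis (0, bar [w]) +
     (\<Sum>S\<in>{S. S \<subset> {..<length w} \<and> 0 \<notin> S \<and> S \<noteq> {}}. split_term w S)"

definition coprod_bar :: "nat list list \<Rightarrow> TV2" where
  "coprod_bar ws = prod_list (map coprod_word ws)"

definition coprod :: "TV \<Rightarrow> TV2" where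
  "coprod = lin_ext (\<lambda>u. coprod_bar (words_of u))"

text \<open>The half-coproducts live on \<open>T\<^sub>+(V)\<close>. They are extended by 0 to the unit, which gives
  half-shuffle products of linear forms the value 0 there.\<close>

definition coprod_prec :: "TV \<Rightarrow> TV2" where
  "coprod_prec = lin_ext (\<lambda>u. case words_of u of [] \<Rightarrow> 0
     | w # ws \<Rightarrow> coprod_prec_word w * coprod_bar ws)"

definition coprod_succ :: "TV \<Rightarrow> TV2" where
  "coprod_succ = lin_ext (\<lambda>u. case words_of u of [] \<Rightarrow> 0
     | w # ws \<Rightarrow> coprod_succ_word w * coprod_bar ws)"


section \<open>Linear forms, convolution and half-shuffle products\<close>

text \<open>\<open>tensor_form \<mu> \<nu>\<close> is \<open>m\<^sub>\<complex> \<circ> (\<mu> \<otimes> \<nu>)\<close>, for linear \<open>\<mu>\<close> and \<open>\<nu>\<close>.\<close>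

definition tensor_form :: "(TV \<Rightarrow> complex) \<Rightarrow> (TV \<Rightarrow> complex) \<Rightarrow> TV2 \<Rightarrow> complex" where
  "tensor_form \<mu> \<nu> = form_ext (\<lambda>(u, v). \<mu> (basis u) * \<nu> (basis v))"

definition conv :: "(TV \<Rightarrow> complex) \<Rightarrow> (TV \<Rightarrow> complex) \<Rightarrow> TV \<Rightarrow> complex" where
  "conv \<mu> \<nu> p = tensor_form \<mu> \<nu> (coprod p)"

definition half_prec :: "(TV \<Rightarrow> complex) \<Rightarrow> (TV \<Rightarrow> complex) \<Rightarrow> TV \<Rightarrow> complex" where
  "half_prec \<mu> \<nu> p = tensor_form \<mu> \<nu> (coprod_prec p)"

definition half_succ :: "(TV \<Rightarrow> complex) \<Rightarrow> (TV \<Rightarrow> complex) \<Rightarrow> TV \<Rightarrow> complex" where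
  "half_succ \<mu> \<nu> p = tensor_form \<mu> \<nu> (coprod_succ p)"

definition counit :: "TV \<Rightarrow> complex" where
  "counit p = Poly_Mapping.lookup p 0"

definition linear_form :: "(TV \<Rightarrow> complex) \<Rightarrow> bool" where
  "linear_form \<mu> \<longleftrightarrow> Vector_Spaces.linear csmult (*) \<mu>"

definition characters :: "(TV \<Rightarrow> complex) set" where
  "characters = {\<mu>. linear_form \<mu> \<and> \<mu> 1 = 1 \<and> (\<forall>p q. \<mu> (p * q) = \<mu> p * \<mu> q)}"

definition char_group :: "(TV \<Rightarrow> complex) monoid" where
  "char_group = \<lparr>carrier = characters, mult = conv, one = counit\<rparr>"

definition inf_characters :: "(TV \<Rightarrow> complex) set" where
  "inf_characters = {\<mu>. linear_form \<mu> \<and> \<mu> 1 = 0 \<and>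
     (\<forall>p. (\<forall>u\<in>Poly_Mapping.keys p. length (words_of u) \<ge> 2) \<longrightarrow> \<mu> p = 0)}"

definition moment_character :: "('b::ring_1 \<Rightarrow> complex) \<Rightarrow> (nat \<Rightarrow> 'b) \<Rightarrow> TV \<Rightarrow> complex" where
  "moment_character \<phi> b =
     form_ext (\<lambda>u. prod_list (map (\<lambda>w. \<phi> (prod_list (map b w))) (words_of u)))"


section \<open>Formal power series in non-commuting variables\<close>

typedef ncps = "UNIV :: (nat list \<Rightarrow> complex) set"
  morphisms coeff Abs_ncps ..

lemma coeff_Abs_ncps [simp]: "coeff (Abs_ncps f) = f"
  by (simp add: Abs_ncps_inverse)

lemma ncps_eqI: "(\<And>w. coeff f w = coeff g w) \<Longrightarrow> f = g"
  by (simp add: coeff_inject[symmetric] fun_eq_iff)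

instantiation ncps :: ring_1
begin

definition zero_ncps :: ncps where
  "0 = Abs_ncps (\<lambda>w. 0)"

definition one_ncps :: ncps where
  "1 = Abs_ncps (\<lambda>w. if w = [] then 1 else 0)"

definition plus_ncps :: "ncps \<Rightarrow> ncps \<Rightarrow> ncps" where
  "f + g = Abs_ncps (\<lambda>w. coeff f w + coeff g w)"

definition uminus_ncps :: "ncps \<Rightarrow> ncps" where
  "- f = Abs_ncps (\<lambda>w. - coeff f w)"

definition minus_ncps :: "ncps \<Rightarrow> ncps \<Rightarrow> ncps" where
  "f - g = Abs_ncps (\<lambda>w. coeff f w - coeff g w)"

definition times_ncps :: "ncps \<Rightarrow> ncps \<Rightarrow> ncps" where
  "f * g = Abs_ncps (\<lambda>w. \<Sum>k\<le>length w. coeff f (take k w) * coeff g (drop k w))"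

instance
proof
  fix f g h :: ncps
  show "f * g * h = f * (g * h)"
  proof (rule ncps_eqI)
    fix w :: "nat list"
    let ?n = "length w"
    let ?F = "\<lambda>j k. coeff f (take j w) * coeff g (take (k - j) (drop j w)) * coeff h (drop k w)"
    have "coeff (f * g * h) w = (\<Sum>k\<le>?n. \<Sum>j\<le>k. ?F j k)"
      by (auto simp: times_ncps_def sum_distrib_right drop_take min_absorb1 min_absorb2 intro!: sum.cong)
    also have "\<dots> = (\<Sum>(k, j)\<in>(SIGMA k:{..?n}. {..k}). ?F j k)"
      by (simp add: sum.Sigma)
    also have "\<dots> = (\<Sum>(j, l)\<in>(SIGMA j:{..?n}. {..?n - j}). ?F j (j + l))"
      by (rule sum.reindex_bij_witness[of _ "\<lambda>(j, l). (j + l, j)" "\<lambda>(k, j). (j, k - j)"]) auto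
    also have "\<dots> = coeff (f * (g * h)) w"
      by (simp add: times_ncps_def sum.Sigma[symmetric] sum_distrib_left mult.assoc add.commute)
    finally show "coeff (f * g * h) w = coeff (f * (g * h)) w" .
  qed
  show "1 * f = f"
  proof (rule ncps_eqI)
    fix w :: "nat list"
    have "coeff (1 * f) w = (\<Sum>k\<in>{0}. coeff 1 (take k w) * coeff f (drop k w))"
      unfolding times_ncps_def coeff_Abs_ncps
      by (rule sum.mono_neutral_right) (auto simp: one_ncps_def)
    then show "coeff (1 * f) w = coeff f w" by (simp add: one_ncps_def)
  qed
  show "f * 1 = f"
  proof (rule ncps_eqI)
    fix w :: "nat list"
    have "coeff (f * 1) w = (\<Sum>k\<in>{length w}. coeff f (take k w) * coeff 1 (drop k w))"
      unfolding times_ncps_def coeff_Abs_ncps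
      by (rule sum.mono_neutral_right) (auto simp: one_ncps_def)
    then show "coeff (f * 1) w = coeff f w" by (simp add: one_ncps_def)
  qed
  have "coeff 0 [] \<noteq> coeff 1 []"
    by (simp add: zero_ncps_def one_ncps_def)
  then show "(0::ncps) \<noteq> 1" by metis
qed (auto intro!: ncps_eqI simp: zero_ncps_def plus_ncps_def uminus_ncps_def minus_ncps_def
    times_ncps_def algebra_simps sum.distrib)

end

definition ncps_var :: "nat \<Rightarrow> ncps" where
  "ncps_var i = Abs_ncps (\<lambda>w. if w = [i] then 1 else 0)"

text \<open>The inverse for the Cauchy product; it exists and is unique if the constant term is 1.\<close>

definition ncps_inverse :: "ncps \<Rightarrow> ncps" where
  "ncps_inverse h = (THE g. h * g = 1 \<and> g * h = 1)"

definition subst_word :: "ncps \<Rightarrow> nat list \<Rightarrow> ncps" where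
  "subst_word h w = prod_list (map (\<lambda>i. ncps_var i * h) w)"

lemma coeff_times_nonzero:
  assumes "coeff (f * g) v \<noteq> 0"
  shows "\<exists>k. coeff f (take k v) \<noteq> 0 \<and> coeff g (drop k v) \<noteq> 0"
  using assms by (auto simp: times_ncps_def elim!: sum.not_neutral_contains_not_neutral)

lemma finite_subst_word: "finite {w. coeff (subst_word h w) v \<noteq> 0}"
proof -
  have "set w \<subseteq> set v \<and> length w \<le> length v" if "coeff (subst_word h w) v \<noteq> 0" for w
    using that
  proof (induction w arbitrary: v)
    case Nil
    then show ?case by simp
  next
    case (Cons i w)
    have "subst_word h (i # w) = ncps_var i * (h * subst_word h w)"
      by (simp add: subst_word_def mult.assoc)
    with Cons.prems obtain k where k: "coeff (ncps_var i) (take k v) \<noteq> 0"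
      "coeff (h * subst_word h w) (drop k v) \<noteq> 0"
      by (metis coeff_times_nonzero)
    obtain l where l: "coeff (subst_word h w) (drop l (drop k v)) \<noteq> 0"
      using coeff_times_nonzero[OF k(2)] by blast
    have tk: "take k v = [i]" using k(1) by (auto simp: ncps_var_def split: if_splits)
    then have v: "v = i # drop k v" by (metis append_Cons append_Nil append_take_drop_id)
    have "set (drop l (drop k v)) \<subseteq> set (drop k v)" "length (drop l (drop k v)) \<le> length (drop k v)"
      by (simp_all only: set_drop_subset length_drop diff_le_self)
    with Cons.IH[OF l] have "set w \<subseteq> set (drop k v)" "length w \<le> length (drop k v)" by auto
    then show ?case by (subst (1 2) v) auto
  qed
  then show ?thesis
    by (intro finite_subset[OF _ finite_lists_length_le[of "set v" "length v"]]) auto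
qed

text \<open>\<open>ncps_subst f h\<close> is \<open>f(x h)\<close>, obtained by substituting \<open>x\<^sub>i h\<close> for each \<open>x\<^sub>i\<close>. Each coefficient
  of the infinite sum \<open>\<Sum>\<^sub>w coeff f w (x h)\<^sub>w\<close> has only finitely many non-zero contributions.\<close>

definition ncps_subst :: "ncps \<Rightarrow> ncps \<Rightarrow> ncps" where
  "ncps_subst f h = Abs_ncps (\<lambda>v.
     \<Sum>w | coeff (subst_word h w) v \<noteq> 0. coeff f w * coeff (subst_word h w) v)"

definition gen_series :: "(TV \<Rightarrow> complex) \<Rightarrow> ncps" where
  "gen_series \<mu> = Abs_ncps (\<lambda>w. if w = [] then \<mu> 1 else \<mu> (basis (bar [w])))"

end

theory Submission
  imports Defs
begin

text \<open>
  Write a word \<open>w\<close> as \<open>g\<^sub>0 s\<^sub>1 g\<^sub>1 \<dots> s\<^sub>k g\<^sub>k\<close>, where \<open>s\<^sub>1, \<dots>, s\<^sub>k\<close> are the letters on the positions in \<open>S\<close>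
  and \<open>g\<^sub>0, \<dots>, g\<^sub>k\<close> are the possibly empty gaps. Summing \<open>\<mu>(w\<^sub>S) \<nu>(g\<^sub>0) \<dots> \<nu>(g\<^sub>k)\<close> over \<open>S\<close> for a
  character \<open>\<nu>\<close> shows that the convolution \<open>\<mu> \<ast> \<nu>\<close> has the generating series
  \<open>N(x) M(x N(x))\<close>, where \<open>M\<close> and \<open>N\<close> are those of \<open>\<mu>\<close> and \<open>\<nu>\<close>. In the left half-shuffle \<open>g\<^sub>0\<close> is
  empty, so the free fixed point equation reads \<open>P(x) = (1 + K)(x P(x))\<close>. In \<open>\<Phi> \<succ> \<beta>\<close> only the
  sets \<open>S\<close> with the single gap \<open>g\<^sub>0\<close> survive, because \<open>\<beta>\<close> vanishes on barred words with at least
  two factors, so the Boolean equation reads \<open>P = 1 + B P\<close>. With \<open>Q = 1 / (1 + K)\<close> the free equation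
  gives \<open>P(x) Q(x P(x)) = 1\<close>, that is, \<open>Q\<close> is the series of a left inverse of \<open>\<Phi>\<close>. Left
  cancellation makes it a two-sided inverse, and \<open>Q(x P(x)) = 1 / P = 1 - B\<close>.
\<close>


section \<open>Non-commutative power series and substitution\<close>


lemma coeff_simps [simp]:
  "coeff 0 w = 0"
  "coeff 1 w = (if w = [] then 1 else 0)"
  "coeff (f + g) w = coeff f w + coeff g w"
  "coeff (f - g) w = coeff f w - coeff g w"
  "coeff (- f) w = - coeff f w"
  by (simp_all add: zero_ncps_def one_ncps_def plus_ncps_def minus_ncps_def uminus_ncps_def)

lemma coeff_times: "coeff (f * g) w = (\<Sum>k\<le>length w. coeff f (take k w) * coeff g (drop k w))"
  by (simp add: times_ncps_def)

lemma coeff_times_Nil [simp]: "coeff (f * g) [] = coeff f [] * coeff g []"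
  by (simp add: coeff_times)

text \<open>Scalars are encoded as constant series, so that the product rule for
  \<open>left_deriv\<close> can be stated inside the ring.\<close>

definition ncps_const :: "complex \<Rightarrow> ncps" where
  "ncps_const c = Abs_ncps (\<lambda>w. if w = [] then c else 0)"

lemma coeff_const_mult: "coeff (ncps_const c * f) w = c * coeff f w"
proof -
  have "coeff (ncps_const c * f) w = (\<Sum>k\<in>{0}. coeff (ncps_const c) (take k w) * coeff f (drop k w))"
    unfolding coeff_times by (rule sum.mono_neutral_right) (auto simp: ncps_const_def)
  then show ?thesis by (simp add: ncps_const_def)
qed

lemma mult_const_left_commute: "f * (ncps_const c * g) = ncps_const c * (f * g)"
  by (rule ncps_eqI) (simp add: coeff_times[of f] coeff_const_mult sum_distrib_left ac_simps)

text \<open>Deletes a leading letter: a series is its constant term plus the sum of all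
  \<open>ncps_var i * left_deriv i f\<close>. This allows recursion on the first letter.\<close>

definition left_deriv :: "nat \<Rightarrow> ncps \<Rightarrow> ncps" where
  "left_deriv i f = Abs_ncps (\<lambda>w. coeff f (i # w))"

lemma coeff_left_deriv [simp]: "coeff (left_deriv i f) w = coeff f (i # w)"
  by (simp add: left_deriv_def)

lemma left_deriv_simps [simp]:
  "left_deriv i 1 = 0"
  "left_deriv i (f + g) = left_deriv i f + left_deriv i g"
  "left_deriv i (ncps_const c * f) = ncps_const c * left_deriv i f"
  by (auto intro!: ncps_eqI simp: coeff_const_mult)

text \<open>In the Cauchy product only the split with empty prefix takes the leading
  \<open>i\<close> from \<open>g\<close>, and it carries the constant term of
  \<open>f\<close>.\<close>

lemma left_deriv_mult:
  "left_deriv i (f * g) = left_deriv i f * g + ncps_const (coeff f []) * left_deriv i g"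
  by (rule ncps_eqI)
    (simp add: coeff_times[of f] coeff_times[of "left_deriv i f"] coeff_const_mult
      sum.atMost_Suc_shift del: sum.atMost_Suc)

lemma finite_words: "finite {w :: nat list. set w \<subseteq> set v \<and> length w \<le> n}"
  by (rule finite_lists_length_le) simp

section \<open>Coefficients of a substitution\<close>

lemma coeff_var_mult: "coeff (ncps_var i * f) w = (case w of [] \<Rightarrow> 0 | j # v \<Rightarrow> if i = j then coeff f v else 0)"
proof (cases w)
  case (Cons j v)
  have "coeff (ncps_var i * f) w = (\<Sum>k\<in>{1}. coeff (ncps_var i) (take k w) * coeff f (drop k w))"
    unfolding coeff_times
  proof (rule sum.mono_neutral_right)
    show "\<forall>k\<in>{..length w} - {1}. coeff (ncps_var i) (take k w) * coeff f (drop k w) = 0"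
    proof
      fix k assume "k \<in> {..length w} - {1}"
      then have "length (take k w) \<noteq> length [i]" by auto
      then have "take k w \<noteq> [i]" by metis
      then show "coeff (ncps_var i) (take k w) * coeff f (drop k w) = 0" by (simp add: ncps_var_def)
    qed
  qed (use Cons in auto)
  then show ?thesis by (auto simp: Cons ncps_var_def)
qed (simp add: ncps_var_def)

lemma coeff_subst_word:
  "coeff (subst_word h []) v = (if v = [] then 1 else 0)"
  "coeff (subst_word h (i # w)) v =
    (case v of [] \<Rightarrow> 0 | j # v \<Rightarrow> if i = j then coeff (h * subst_word h w) v else 0)"
  by (auto simp: subst_word_def mult.assoc coeff_var_mult split: list.splits)

text \<open>Each factor \<open>ncps_var i * h\<close> puts its own letter \<open>i\<close> into the
  monomial, whatever \<open>h\<close> adds.\<close>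

lemma subst_word_support:
  assumes "coeff (subst_word h w) v \<noteq> 0"
  shows "set w \<subseteq> set v \<and> length w \<le> length v"
  using assms
proof (induction w arbitrary: v)
  case (Cons i w)
  then obtain u where v: "v = i # u" and "coeff (h * subst_word h w) u \<noteq> 0"
    by (auto simp: coeff_subst_word split: list.splits if_splits)
  then obtain k where "coeff (subst_word h w) (drop k u) \<noteq> 0"
    using coeff_times_nonzero by blast
  from Cons.IH[OF this] have "set w \<subseteq> set u" "length w \<le> length u"
    by (auto dest: in_set_dropD)
  then show ?case by (auto simp: v)
qed simp

text \<open>The set summed over in \<open>ncps_subst\<close> depends on \<open>h\<close>; a common
  finite superset makes the sums for different \<open>f\<close> and \<open>h\<close>
  comparable.\<close>

lemma coeff_subst:
  assumes "finite A" "{w. set w \<subseteq> set v \<and> length w \<le> length v} \<subseteq> A"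
  shows "coeff (ncps_subst f h) v = (\<Sum>w\<in>A. coeff f w * coeff (subst_word h w) v)"
  unfolding ncps_subst_def coeff_Abs_ncps
proof (rule sum.mono_neutral_left)
  show "{w. coeff (subst_word h w) v \<noteq> 0} \<subseteq> A"
    using assms(2) subst_word_support by blast
qed (use assms(1) in auto)

lemma coeff_subst_Nil [simp]: "coeff (ncps_subst f h) [] = coeff f []"
proof -
  have "{w :: nat list. set w \<subseteq> set [] \<and> length w \<le> length []} \<subseteq> {[]}" by auto
  from coeff_subst[OF _ this, of f h] show ?thesis by (simp add: coeff_subst_word)
qed

text \<open>If \<open>f\<^sub>i\<close> are the left derivatives and \<open>f\<^sub>0\<close> is the
  constant term, then \<open>f(x h)\<close> is \<open>f\<^sub>0\<close> plus the sum of all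
  \<open>x\<^sub>i h f\<^sub>i(x h)\<close>.\<close>

lemma left_deriv_subst: "left_deriv i (ncps_subst f h) = h * ncps_subst (left_deriv i f) h"
proof (rule ncps_eqI)
  fix v
  let ?A = "{w. set w \<subseteq> set (i # v) \<and> length w \<le> length v}"
  let ?B = "insert [] {w. set w \<subseteq> set (i # v) \<and> length w \<le> length (i # v)}"
  have finA: "finite ?A" and finB: "finite ?B" using finite_words by blast+
  have "coeff (left_deriv i (ncps_subst f h)) v
      = (\<Sum>w\<in>?B. coeff f w * coeff (subst_word h w) (i # v))"
    unfolding coeff_left_deriv by (rule coeff_subst[OF finB]) auto
  \<comment> \<open>A substituted monomial begins with the first letter of its word, so only words
    beginning with \<open>i\<close> contribute.\<close>
  also have "\<dots> = (\<Sum>w\<in>(#) i ` ?A. coeff f w * coeff (subst_word h w) (i # v))"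
  proof (rule sum.mono_neutral_right)
    show "\<forall>w\<in>?B - (#) i ` ?A. coeff f w * coeff (subst_word h w) (i # v) = 0"
    proof
      fix w assume w: "w \<in> ?B - (#) i ` ?A"
      show "coeff f w * coeff (subst_word h w) (i # v) = 0"
        using w by (cases w) (auto simp: coeff_subst_word image_iff)
    qed
  qed (use finB in auto)
  also have "\<dots> = (\<Sum>u\<in>?A. coeff f (i # u) * coeff (h * subst_word h u) v)"
    by (subst sum.reindex) (auto simp: coeff_subst_word)
  also have "\<dots> = (\<Sum>k\<le>length v. coeff h (take k v) *
      (\<Sum>u\<in>?A. coeff (left_deriv i f) u * coeff (subst_word h u) (drop k v)))"
    unfolding coeff_times sum_distrib_left
    by (subst sum.swap) (simp add: ac_simps)
  also have "\<dots> = coeff (h * ncps_subst (left_deriv i f) h) v"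
    unfolding coeff_times
    by (intro sum.cong refl arg_cong2[of _ _ _ _ "(*)"] coeff_subst[symmetric] finA)
      (auto dest: in_set_dropD)
  finally show "coeff (left_deriv i (ncps_subst f h)) v = coeff (h * ncps_subst (left_deriv i f) h) v" .
qed

text \<open>Identities between series built with \<open>ncps_subst\<close> are proved by induction on the order of
  agreement, because \<open>left_deriv_subst\<close> turns a substitution into a product with a substitution.\<close>

definition agree :: "nat \<Rightarrow> ncps \<Rightarrow> ncps \<Rightarrow> bool" where
  "agree n f g \<longleftrightarrow> (\<forall>w. length w < n \<longrightarrow> coeff f w = coeff g w)"

lemma agree_eqI: "(\<And>n. agree n f g) \<Longrightarrow> f = g"
  unfolding agree_def by (rule ncps_eqI) blast

lemma agree_refl [simp]: "agree n f f"
  by (simp add: agree_def)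

lemma agree_0 [simp]: "agree 0 f g"
  by (simp add: agree_def)

lemma agree_SucI:
  assumes "coeff f [] = coeff g []" "\<And>i. agree n (left_deriv i f) (left_deriv i g)"
  shows "agree (Suc n) f g"
  unfolding agree_def
proof safe
  fix w :: "nat list" assume "length w < Suc n"
  then show "coeff f w = coeff g w"
    using assms by (cases w) (auto simp: agree_def)
qed

lemma agree_add: "agree n f f' \<Longrightarrow> agree n g g' \<Longrightarrow> agree n (f + g) (f' + g')"
  by (simp add: agree_def)

lemma agree_mult: "agree n f f' \<Longrightarrow> agree n g g' \<Longrightarrow> agree n (f * g) (f' * g')"
  by (simp add: agree_def coeff_times)

lemma subst_add: "ncps_subst (f + g) h = ncps_subst f h + ncps_subst g h"
  by (rule ncps_eqI) (simp add: coeff_subst[OF finite_words subset_refl] distrib_right sum.distrib)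

lemma subst_const_mult: "ncps_subst (ncps_const c * f) h = ncps_const c * ncps_subst f h"
  by (rule ncps_eqI)
    (simp add: coeff_subst[OF finite_words subset_refl] coeff_const_mult sum_distrib_left mult.assoc)

lemma subst_0 [simp]: "ncps_subst 0 h = 0"
  by (rule ncps_eqI) (simp add: ncps_subst_def)

lemma subst_1 [simp]: "ncps_subst 1 h = 1"
proof (rule agree_eqI)
  show "agree n (ncps_subst 1 h) 1" for n
    by (cases n) (auto intro: agree_SucI simp: left_deriv_subst)
qed

text \<open>The product rule expands the left derivatives of both sides into matching sums, which
  differ only by instances of the claim one order lower. There a factor is replaced by its left
  derivative, so \<open>f\<close> and \<open>g\<close> stay arbitrary.\<close>

lemma subst_mult: "ncps_subst (f * g) h = ncps_subst f h * ncps_subst g h"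
proof (rule agree_eqI)
  show "agree n (ncps_subst (f * g) h) (ncps_subst f h * ncps_subst g h)" for n
  proof (induction n arbitrary: f g)
    case (Suc n)
    show ?case
    proof (rule agree_SucI)
      fix i
      show "agree n (left_deriv i (ncps_subst (f * g) h)) (left_deriv i (ncps_subst f h * ncps_subst g h))"
        unfolding left_deriv_subst left_deriv_mult subst_add subst_const_mult
          distrib_left mult_const_left_commute coeff_subst_Nil mult.assoc
        by (intro agree_add agree_mult agree_refl Suc.IH)
    qed simp
  qed simp
qed

text \<open>The second substitution turns \<open>x\<^sub>i g\<close> into
  \<open>x\<^sub>i h g(x h)\<close>. Both left derivatives have the left factor
  \<open>h * ncps_subst g h\<close>, and what remains is the claim for
  \<open>left_deriv i f\<close>.\<close>

lemma subst_subst: "ncps_subst (ncps_subst f g) h = ncps_subst f (h * ncps_subst g h)"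
proof (rule agree_eqI)
  show "agree n (ncps_subst (ncps_subst f g) h) (ncps_subst f (h * ncps_subst g h))" for n
  proof (induction n arbitrary: f)
    case (Suc n)
    show ?case
    proof (rule agree_SucI)
      fix i
      show "agree n (left_deriv i (ncps_subst (ncps_subst f g) h))
          (left_deriv i (ncps_subst f (h * ncps_subst g h)))"
        unfolding left_deriv_subst subst_mult mult.assoc
        by (intro agree_mult agree_refl Suc.IH)
    qed simp
  qed simp
qed

lemma subst_by_1 [simp]: "ncps_subst f 1 = f"
proof (rule agree_eqI)
  show "agree n (ncps_subst f 1) f" for n
    by (induction n arbitrary: f) (auto intro!: agree_SucI simp: left_deriv_subst)
qed

text \<open>One order is gained because every copy of the substituted series stands behind a
  variable.\<close>

lemma agree_subst: "agree n g h \<Longrightarrow> agree (Suc n) (ncps_subst f g) (ncps_subst f h)"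
proof (induction n arbitrary: f)
  case (Suc n)
  have "agree (Suc n) (ncps_subst f g) (ncps_subst f h)" for f
    using Suc.IH Suc.prems by (simp add: agree_def)
  then show ?case
    using Suc.prems by (intro agree_SucI[of _ _ "Suc n"]) (simp_all add: left_deriv_subst agree_mult)
qed (auto intro: agree_SucI)

text \<open>The group law of characters, transported to generating series.\<close>

definition char_mult :: "ncps \<Rightarrow> ncps \<Rightarrow> ncps"  (infixl \<open>\<star>\<close> 70) where
  "f \<star> g = g * ncps_subst f g"

lemma char_mult_assoc: "f \<star> g \<star> h = f \<star> (g \<star> h)"
  by (simp add: char_mult_def subst_mult subst_subst mult.assoc)

lemma char_mult_1 [simp]: "1 \<star> f = f" "f \<star> 1 = f"
  by (simp_all add: char_mult_def)

text \<open>The coefficient of \<open>f \<star> g\<close> at a word of length \<open>n\<close> is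
  that of \<open>g\<close> plus terms that depend on \<open>g\<close> only in degrees below
  \<open>n\<close>. So \<open>g\<close> is determined degree by degree.\<close>

lemma char_mult_left_cancel:
  assumes f: "coeff f [] = 1" and eq: "f \<star> g = f \<star> h"
  shows "g = h"
proof (rule agree_eqI)
  show "agree n g h" for n
  proof (induction n)
    case (Suc n)
    have "coeff g v = coeff h v" if "length v < Suc n" for v
    proof (cases "length v = n")
      case True
      \<comment> \<open>The split with empty suffix is isolated; its second factor is the constant
        term 1 of \<open>f\<close>.\<close>
      have split: "coeff (f \<star> k) v = (\<Sum>j<length v. coeff k (take j v) * coeff (ncps_subst f k) (drop j v))
          + coeff k v" for k
        by (simp add: char_mult_def coeff_times lessThan_Suc_atMost[symmetric] f)
      have "(\<Sum>j<length v. coeff g (take j v) * coeff (ncps_subst f g) (drop j v))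
          = (\<Sum>j<length v. coeff h (take j v) * coeff (ncps_subst f h) (drop j v))"
        using Suc.IH agree_subst[OF Suc.IH, of f] True by (intro sum.cong) (auto simp: agree_def)
      then show ?thesis using split[of g] split[of h] eq by simp
    qed (use Suc.IH that in \<open>simp add: agree_def\<close>)
    then show ?case by (simp add: agree_def)
  qed simp
qed

section \<open>Inverses for the Cauchy product\<close>

context
  notes sum.cong [fundef_cong]
begin

text \<open>Solves \<open>h * g = 1\<close> at the word \<open>i # v\<close>: for \<open>h\<close>
  with constant term 1, the split with empty prefix is the unknown coefficient of \<open>g\<close>,
  and all other splits involve shorter words.\<close>

function right_inv_coeff :: "ncps \<Rightarrow> nat list \<Rightarrow> complex" where
  "right_inv_coeff h [] = 1"
| "right_inv_coeff h (i # v) = - (\<Sum>k\<le>length v. coeff h (i # take k v) * right_inv_coeff h (drop k v))"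
  by pat_completeness auto
termination by (relation "measure (\<lambda>(h, w). length w)") auto

end

lemma ex_right_inverse:
  assumes "coeff h [] = 1"
  shows "\<exists>g. coeff g [] = 1 \<and> h * g = 1"
proof (intro exI conjI)
  let ?g = "Abs_ncps (right_inv_coeff h)"
  show "coeff ?g [] = 1" by simp
  show "h * ?g = 1"
  proof (rule ncps_eqI)
    fix w show "coeff (h * ?g) w = coeff 1 w"
      using assms by (cases w) (simp_all add: coeff_times sum.atMost_Suc_shift del: sum.atMost_Suc)
  qed
qed

text \<open>The right inverse \<open>g\<close> has constant term 1 and so has a right inverse
  itself; by associativity that one is \<open>h\<close>, so \<open>g\<close> is the unique two-sided
  inverse.\<close>

lemma ncps_inverse_props:
  assumes "coeff h [] = 1"
  shows "h * ncps_inverse h = 1" "ncps_inverse h * h = 1" "coeff (ncps_inverse h) [] = 1"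
proof -
  obtain g where g: "coeff g [] = 1" "h * g = 1" using ex_right_inverse[OF assms] by blast
  obtain k where "g * k = 1" using ex_right_inverse[OF g(1)] by blast
  with g(2) have gh: "g * h = 1" by (metis mult.assoc mult.left_neutral mult.right_neutral)
  have "ncps_inverse h = g"
    unfolding ncps_inverse_def
    using g gh by (intro the_equality) (auto, metis mult.assoc mult.left_neutral mult.right_neutral)
  then show "h * ncps_inverse h = 1" "ncps_inverse h * h = 1" "coeff (ncps_inverse h) [] = 1"
    using g gh by auto
qed


section \<open>Gaps of a set of positions\<close>

text \<open>Maximality of an interval only has to be tested at its two neighbouring positions. The
  left test is vacuous for \<open>a = 0\<close>, the right one at the end of the word.\<close>

lemma gaps_iff:
  "J \<in> gaps n S \<longleftrightarrow> (\<exists>a b. J = {a..b} \<and> a \<le> b \<and> b < n \<and> {a..b} \<inter> S = {} \<and>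
     (\<forall>i. a = Suc i \<longrightarrow> i \<in> S) \<and> (Suc b < n \<longrightarrow> Suc b \<in> S))"
  (is "_ \<longleftrightarrow> (\<exists>a b. ?P a b)")
proof
  assume J: "J \<in> gaps n S"
  then obtain a b where ab: "a \<le> b" "J = {a..b}" "{a..b} \<subseteq> {..<n} - S" by (auto simp: gaps_def)
  have max: "{c..d} = {a..b}" if "{a..b} \<subseteq> {c..d}" "{c..d} \<subseteq> {..<n} - S" for c d
    using J that ab(2) unfolding gaps_def by blast
  have "i \<in> S" if "a = Suc i" for i
  proof (rule ccontr)
    have *: "{i..b} = insert i {a..b}" using ab that by auto
    assume "i \<notin> S"
    then have "{i..b} = {a..b}" using ab that by (intro max) (auto simp: *)
    then show False using * that by auto
  qed
  moreover have "Suc b \<in> S" if "Suc b < n"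
  proof (rule ccontr)
    have *: "{a..Suc b} = insert (Suc b) {a..b}" using ab by auto
    assume "Suc b \<notin> S"
    then have "{a..Suc b} = {a..b}" using ab that by (intro max) (auto simp: *)
    then show False using * by auto
  qed
  ultimately have "?P a b" using ab by auto
  then show "\<exists>a b. ?P a b" by blast
next
  assume "\<exists>a b. ?P a b"
  then obtain a b where ab: "?P a b" by blast
  have "{c..d} = J" if cd: "J \<subseteq> {c..d}" "{c..d} \<subseteq> {..<n} - S" for c d
  proof -
    have "c \<le> a" "b \<le> d" using cd ab by auto
    moreover have "\<not> c < a"
    proof
      assume "c < a"
      then obtain i where "a = Suc i" "i \<in> S" using ab by (cases a) auto
      moreover have "i \<in> {c..d}" using \<open>c < a\<close> \<open>b \<le> d\<close> \<open>a = Suc i\<close> ab by auto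
      ultimately show False using cd by blast
    qed
    moreover have "\<not> b < d"
    proof
      assume "b < d"
      then have "Suc b \<in> {c..d}" using \<open>c \<le> a\<close> ab by auto
      then show False using cd ab by blast
    qed
    ultimately show ?thesis using ab by auto
  qed
  then show "J \<in> gaps n S" using ab by (auto simp: gaps_def)
qed

lemma gap_list_eqI: "set Js = gaps n S \<Longrightarrow> sorted_wrt before Js \<Longrightarrow> gap_list n S = Js"
  unfolding gap_list_def using ex1_gap_list by (intro the1_equality) auto

lemma gap_list_props: "set (gap_list n S) = gaps n S" "sorted_wrt before (gap_list n S)"
  using theI'[OF ex1_gap_list, of n S] by (simp_all add: gap_list_def)

lemma gap_list_full: "gap_list n {..<n} = []"
  by (rule gap_list_eqI) (fastforce simp: gaps_iff)+

text \<open>A position outside \<open>T\<close> lies in some gap, found by extending it as far as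
  possible first to the left and then to the right.\<close>

lemma gap_list_eq_Nil_iff:
  assumes "T \<subseteq> {..<n}"
  shows "gap_list n T = [] \<longleftrightarrow> T = {..<n}"
proof
  assume "gap_list n T = []"
  then have none: "gaps n T = {}" using gap_list_props(1)[of n T] by simp
  have "i \<in> T" if i: "i < n" for i
  proof (rule ccontr)
    assume nT: "i \<notin> T"
    define P where "P a b \<longleftrightarrow> a \<le> i \<and> i \<le> b \<and> b < n \<and> {a..b} \<inter> T = {}" for a b
    define a where "a = (LEAST a. P a i)"
    have "P i i" using i nT by (simp add: P_def)
    then have a: "P a i"
      unfolding a_def by (rule LeastI)
    have a_le: "a \<le> a'" if "P a' i" for a'
      unfolding a_def using that by (rule Least_le)
    define b where "b = (GREATEST b. P a b)"
    have bound: "\<And>b. P a b \<Longrightarrow> b \<le> n" by (simp add: P_def)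
    have b: "P a b"
      unfolding b_def using a bound by (rule GreatestI_nat)
    have b_ge: "b' \<le> b" if "P a b'" for b'
      unfolding b_def using that bound by (rule Greatest_le_nat)
    have "j \<in> T" if "a = Suc j" for j
    proof (rule ccontr)
      assume "j \<notin> T"
      moreover have "{j..i} = insert j {a..i}" using that a by (auto simp: P_def)
      ultimately have "P j i" using a that by (auto simp: P_def)
      then show False using a_le that by force
    qed
    moreover have "Suc b \<in> T" if "Suc b < n"
    proof (rule ccontr)
      assume "Suc b \<notin> T"
      moreover have "{a..Suc b} = insert (Suc b) {a..b}" using b by (auto simp: P_def)
      ultimately have "P a (Suc b)" using b that by (auto simp: P_def)
      then show False using b_ge by force
    qed
    ultimately have "{a..b} \<in> gaps n T"
      using b unfolding gaps_iff P_def by (intro exI[of _ a] exI[of _ b]) auto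
    then show False using none by simp
  qed
  then show "T = {..<n}" using assms by auto
qed (simp add: gap_list_full)

lemma gap_list_empty: "gap_list n {} = (if n = 0 then [] else [{..<n}])"
proof (cases n)
  case (Suc m)
  have "gaps n {} = {{..<n}}"
  proof (intro subset_antisym subsetI)
    fix J assume "J \<in> gaps n {}"
    then obtain a b where ab: "J = {a..b}" "b < n" "\<forall>i. a \<noteq> Suc i" "\<not> Suc b < n"
      by (auto simp: gaps_iff)
    then have "a = 0" by (cases a) auto
    then show "J \<in> {{..<n}}" using ab by auto
  next
    fix J assume "J \<in> {{..<n}}"
    then show "J \<in> gaps n {}"
      unfolding gaps_iff Suc by (intro exI[of _ 0] exI[of _ m]) auto
  qed
  then show ?thesis by (intro gap_list_eqI) (auto simp: Suc)
qed (use gap_list_full[of 0] in simp)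

text \<open>Every non-empty set of positions is \<open>prepend k T\<close> with \<open>k\<close> its minimum; the gaps beyond \<open>k\<close>
  are then the shifted gaps of \<open>T\<close> in a word of length \<open>n - Suc k\<close>.\<close>

definition prepend :: "nat \<Rightarrow> nat set \<Rightarrow> nat set" where
  "prepend k T = insert k ((+) (Suc k) ` T)"

lemma zero_in_prepend [simp]: "0 \<in> prepend k T \<longleftrightarrow> k = 0"
  by (auto simp: prepend_def)

text \<open>No gap contains \<open>k\<close>. Left of \<open>k\<close> nothing is selected, so those
  positions form one gap, absent for \<open>k = 0\<close>; right of \<open>k\<close> the endpoint
  tests are those for \<open>T\<close>, shifted.\<close>

lemma gap_list_prepend:
  assumes "k < n" "T \<subseteq> {..<n - Suc k}"
  shows "gap_list n (prepend k T) =
    (if k = 0 then [] else [{..<k}]) @ map ((`) ((+) (Suc k))) (gap_list (n - Suc k) T)"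
  unfolding prepend_def
proof (rule gap_list_eqI)
  let ?S = "insert k ((+) (Suc k) ` T)" and ?m = "n - Suc k" and ?s = "(+) (Suc k)"
  have S: "i \<in> ?S \<longleftrightarrow> i = k \<or> Suc k \<le> i \<and> i - Suc k \<in> T" for i
    by (auto simp: image_iff dest!: le_Suc_ex)
  have "J \<in> gaps n ?S \<longleftrightarrow> (k \<noteq> 0 \<and> J = {..<k}) \<or> J \<in> (`) ?s ` gaps ?m T" for J
  proof
    assume "J \<in> gaps n ?S"
    then obtain a b where ab: "J = {a..b}" "a \<le> b" "b < n" "{a..b} \<inter> ?S = {}"
      "\<And>i. a = Suc i \<Longrightarrow> i \<in> ?S" "Suc b < n \<Longrightarrow> Suc b \<in> ?S"
      unfolding gaps_iff by blast
    have disj: "i \<notin> ?S" if "a \<le> i" "i \<le> b" for i using that ab(4) by auto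
    then have "\<not> (a \<le> k \<and> k \<le> b)" by blast
    then consider "b < k" | "k < a" by linarith
    then show "(k \<noteq> 0 \<and> J = {..<k}) \<or> J \<in> (`) ?s ` gaps ?m T"
    proof cases
      case 1
      have "a = 0"
      proof (rule ccontr)
        assume "a \<noteq> 0"
        then obtain i where "a = Suc i" by (cases a) auto
        with ab(5)[OF this] ab(2) 1 show False unfolding S by auto
      qed
      moreover have "Suc b = k" using ab(6) 1 assms unfolding S by auto
      ultimately show ?thesis using ab by auto
    next
      case 2
      define a' b' where "a' = a - Suc k" and "b' = b - Suc k"
      have a'b': "a = Suc k + a'" "b = Suc k + b'" using 2 ab(2) by (auto simp: a'_def b'_def)
      have "J = ?s ` {a'..b'}" using ab by (simp only: a'b' image_add_atLeastAtMost add.commute)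
      moreover have "{a'..b'} \<in> gaps ?m T"
        unfolding gaps_iff
      proof (intro exI conjI)
        show "{a'..b'} = {a'..b'}" "a' \<le> b'" "b' < ?m" using ab(2,3) a'b' by auto
        show "{a'..b'} \<inter> T = {}"
        proof (rule equals0I)
          fix i assume "i \<in> {a'..b'} \<inter> T"
          then show False using disj[of "Suc k + i"] a'b' by auto
        qed
        show "\<forall>i. a' = Suc i \<longrightarrow> i \<in> T" using ab(5) a'b' unfolding S by force
        show "Suc b' < ?m \<longrightarrow> Suc b' \<in> T" using ab(6) a'b' unfolding S by force
      qed
      ultimately show ?thesis by blast
    qed
  next
    assume "(k \<noteq> 0 \<and> J = {..<k}) \<or> J \<in> (`) ?s ` gaps ?m T"
    then show "J \<in> gaps n ?S"
    proof
      assume "k \<noteq> 0 \<and> J = {..<k}"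
      then show ?thesis
        unfolding gaps_iff using assms by (intro exI[of _ 0] exI[of _ "k - 1"]) (auto simp: S)
    next
      assume "J \<in> (`) ?s ` gaps ?m T"
      then obtain a b where ab: "J = ?s ` {a..b}" "a \<le> b" "b < ?m" "{a..b} \<inter> T = {}"
        "\<And>i. a = Suc i \<Longrightarrow> i \<in> T" "Suc b < ?m \<Longrightarrow> Suc b \<in> T"
        by (auto simp: gaps_iff)
      have "J = {Suc k + a..Suc k + b}" using ab by (simp only: image_add_atLeastAtMost add.commute)
      then show ?thesis
        unfolding gaps_iff
      proof (intro exI conjI)
        show "Suc k + a \<le> Suc k + b" "Suc k + b < n" using ab by auto
        show "{Suc k + a..Suc k + b} \<inter> ?S = {}"
          using ab(4) by (auto simp: disjoint_iff)
        show "\<forall>i. Suc k + a = Suc i \<longrightarrow> i \<in> ?S"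
          using ab(5) unfolding S by (cases a) auto
        show "Suc (Suc k + b) < n \<longrightarrow> Suc (Suc k + b) \<in> ?S"
          using ab(6) unfolding S by auto
      qed
    qed
  qed
  then show "set ((if k = 0 then [] else [{..<k}]) @ map ((`) ?s) (gap_list ?m T)) = gaps n ?S"
    using gap_list_props(1)[of ?m T] by (auto split: if_splits)
  have "sorted_wrt before (map ((`) ?s) (gap_list ?m T))"
    unfolding sorted_wrt_map using gap_list_props(2)
    by (rule sorted_wrt_mono_rel[rotated]) (auto simp: before_def)
  then show "sorted_wrt before ((if k = 0 then [] else [{..<k}]) @ map ((`) ?s) (gap_list ?m T))"
    by (auto simp: sorted_wrt_append before_def)
qed

lemma sum_Pow_by_Min:
  fixes g :: "nat set \<Rightarrow> 'a::comm_monoid_add"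
  shows "(\<Sum>S\<in>Pow {..<n}. g S) =
    g {} + (\<Sum>k<n. \<Sum>T\<in>Pow {..<n - Suc k}. g (prepend k T))"
  unfolding prepend_def
proof (induction n arbitrary: g)
  case (Suc n)
  have "Pow {..<Suc n} = (`) Suc ` Pow {..<n} \<union> (\<lambda>T. insert 0 (Suc ` T)) ` Pow {..<n}"
    by (simp add: lessThan_Suc_eq_insert_0 Pow_insert image_Pow_surj[OF refl, symmetric] image_image)
  also have "(\<Sum>S\<in>\<dots>. g S) = (\<Sum>T\<in>Pow {..<n}. g (Suc ` T)) + (\<Sum>T\<in>Pow {..<n}. g (insert 0 (Suc ` T)))"
  proof (subst sum.union_disjoint)
    have "inj_on (\<lambda>T. insert 0 (Suc ` T)) (Pow {..<n})"
    proof (rule inj_onI)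
      fix A B assume "insert 0 (Suc ` A) = insert 0 (Suc ` B)"
      then have "Suc ` A = Suc ` B" by (metis Diff_insert_absorb imageE nat.distinct(1))
      then show "A = B" by (simp add: inj_image_eq_iff)
    qed
    then show "(\<Sum>S\<in>(`) Suc ` Pow {..<n}. g S) + (\<Sum>S\<in>(\<lambda>T. insert 0 (Suc ` T)) ` Pow {..<n}. g S) =
        (\<Sum>T\<in>Pow {..<n}. g (Suc ` T)) + (\<Sum>T\<in>Pow {..<n}. g (insert 0 (Suc ` T)))"
      by (subst (1 2) sum.reindex) (auto intro!: inj_onI simp: inj_image_eq_iff)
  qed auto
  \<comment> \<open>The induction hypothesis for the shifted sets supplies \<open>g {}\<close> and
    the positive minima; the sets containing 0 are the summand \<open>k = 0\<close>.\<close>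
  also have "\<dots> = g {} + (\<Sum>k<Suc n. \<Sum>T\<in>Pow {..<Suc n - Suc k}. g (insert k ((+) (Suc k) ` T)))"
    by (simp add: Suc.IH[of "\<lambda>T. g (Suc ` T)"] sum.lessThan_Suc_shift image_image ac_simps
        del: sum.lessThan_Suc)
  finally show ?case .
qed simp

section \<open>Subwords on shifted sets of positions\<close>

lemma nths_shift: "nths w ((+) k ` T) = nths (drop k w) T"
proof (induction k arbitrary: w)
  case (Suc k)
  show ?case
  proof (cases w)
    case (Cons x xs)
    have "{j. Suc j \<in> (+) (Suc k) ` T} = (+) k ` T" by auto
    then show ?thesis by (simp add: Cons nths_Cons Suc.IH) auto
  qed simp
qed simp

lemma nths_prepend:
  "k < length w \<Longrightarrow> nths w (prepend k T) = w ! k # nths (drop (Suc k) w) T"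
  unfolding prepend_def
proof (induction k arbitrary: w)
  case 0
  then obtain x xs where "w = x # xs" by (cases w) auto
  moreover have "{j. Suc j \<in> insert 0 (Suc ` T)} = T" by auto
  ultimately show ?case by (simp add: nths_Cons)
next
  case (Suc k)
  then obtain x xs where w: "w = x # xs" by (cases w) auto
  moreover have "{j. Suc j \<in> insert (Suc k) ((+) (Suc (Suc k)) ` T)} = insert k ((+) (Suc k) ` T)" by auto
  moreover have "0 \<notin> insert (Suc k) ((+) (Suc (Suc k)) ` T)" by auto
  ultimately show ?case using Suc by (simp only: nths_Cons) simp
qed


section \<open>Linear forms and characters\<close>

lemma form_ext_superset:
  assumes "finite A" "Poly_Mapping.keys p \<subseteq> A"
  shows "form_ext f p = (\<Sum>u\<in>A. Poly_Mapping.lookup p u * f u)"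
  unfolding form_ext_def using assms by (intro sum.mono_neutral_left) (auto simp: in_keys_iff)

lemma form_ext_add: "form_ext f (p + q) = form_ext f p + form_ext f q"
proof -
  let ?A = "Poly_Mapping.keys p \<union> Poly_Mapping.keys q"
  have "form_ext f (p + q) = (\<Sum>u\<in>?A. Poly_Mapping.lookup (p + q) u * f u)"
    by (rule form_ext_superset) (auto simp: keys_add)
  also have "\<dots> = form_ext f p + form_ext f q"
    by (simp add: form_ext_superset[of ?A] lookup_add distrib_right sum.distrib)
  finally show ?thesis .
qed

lemma form_ext_csmult: "form_ext f (csmult c p) = c * form_ext f p"
proof -
  have "form_ext f (csmult c p) = (\<Sum>u\<in>Poly_Mapping.keys p. Poly_Mapping.lookup (csmult c p) u * f u)"
    by (rule form_ext_superset) (auto simp: in_keys_iff lookup_csmult)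
  then show ?thesis by (simp add: lookup_csmult form_ext_def sum_distrib_left mult.assoc)
qed

lemma form_ext_0 [simp]: "form_ext f 0 = 0"
  by (simp add: form_ext_def)

lemma form_ext_sum: "form_ext f (\<Sum>x\<in>A. g x) = (\<Sum>x\<in>A. form_ext f (g x))"
  by (induction A rule: infinite_finite_induct) (auto simp: form_ext_add)

lemma form_ext_single: "form_ext f (Poly_Mapping.single u c) = c * f u"
  by (simp add: form_ext_def)

lemma form_ext_basis [simp]: "form_ext f (basis u) = f u"
  by (simp add: basis_def form_ext_single)

lemma poly_mapping_sum_single:
  fixes p :: "'k \<Rightarrow>\<^sub>0 'c::comm_monoid_add"
  shows "p = (\<Sum>u\<in>Poly_Mapping.keys p. Poly_Mapping.single u (Poly_Mapping.lookup p u))"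
proof (rule poly_mapping_eqI)
  fix k
  have "(\<Sum>u\<in>Poly_Mapping.keys p. Poly_Mapping.lookup p u when u = k) = Poly_Mapping.lookup p k"
    by (cases "k \<in> Poly_Mapping.keys p") (auto simp: when_def in_keys_iff)
  then show "Poly_Mapping.lookup p k = Poly_Mapping.lookup
      (\<Sum>u\<in>Poly_Mapping.keys p. Poly_Mapping.single u (Poly_Mapping.lookup p u)) k"
    by (simp add: lookup_sum lookup_single)
qed

lemma form_ext_mult:
  fixes f :: "'k::monoid_add \<Rightarrow> complex"
  assumes "\<And>u v. f (u + v) = f u * f v"
  shows "form_ext f (p * q) = form_ext f p * form_ext f q"
proof -
  have "form_ext f (p * q) = (\<Sum>u\<in>Poly_Mapping.keys p. \<Sum>v\<in>Poly_Mapping.keys q.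
      form_ext f (Poly_Mapping.single u (Poly_Mapping.lookup p u) * Poly_Mapping.single v (Poly_Mapping.lookup q v)))"
    by (subst poly_mapping_sum_single[of p], subst poly_mapping_sum_single[of q])
      (simp add: sum_product form_ext_sum)
  also have "\<dots> = form_ext f p * form_ext f q"
    by (simp add: mult_single form_ext_single assms form_ext_def[of f p]
        form_ext_def[of f q] sum_product ac_simps)
  finally show ?thesis .
qed

lemma form_ext_one [simp]: "form_ext f (1 :: 'k::monoid_add \<Rightarrow>\<^sub>0 complex) = f 0"
  using form_ext_single[of f 0 1] by simp

lemma form_ext_lin_ext: "form_ext f (lin_ext g p) = form_ext (\<lambda>u. form_ext f (g u)) p"
  by (simp add: lin_ext_def form_ext_sum form_ext_csmult form_ext_def[of _ p])

lemma vector_space_complex: "vector_space ((*) :: complex \<Rightarrow> _)"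
  by unfold_locales (simp_all add: algebra_simps)

lemma linear_form_form_ext: "linear_form (form_ext f)"
  unfolding linear_form_def
  by (intro Vector_Spaces.linear_iff[THEN iffD2] conjI allI vector_space_csmult
      vector_space_complex form_ext_add form_ext_csmult)

lemma linear_form_eq_form_ext:
  assumes "linear_form \<mu>"
  shows "\<mu> p = form_ext (\<lambda>u. \<mu> (basis u)) p"
proof -
  interpret Vector_Spaces.linear csmult "(*)" \<mu> using assms by (simp add: linear_form_def)
  have "Poly_Mapping.single u c = csmult c (basis u)" for u :: barword and c
    by (rule poly_mapping_eqI) (simp add: lookup_csmult basis_def lookup_single when_def)
  then have "\<mu> p = \<mu> (\<Sum>u\<in>Poly_Mapping.keys p. csmult (Poly_Mapping.lookup p u) (basis u))"
    using poly_mapping_sum_single[of p] by simp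
  then show ?thesis by (simp add: sum scale form_ext_def)
qed

lemma basis_0: "basis 0 = (1 :: 'k::monoid_add \<Rightarrow>\<^sub>0 complex)"
  by (simp add: basis_def)

lemma basis_add: "basis (u + v) = basis u * basis v"
  by (simp add: basis_def mult_single)

lemma words_of_0 [simp]: "words_of 0 = []"
  by (simp add: zero_barword_def words_of_bar)

lemma bar_append: "bar (us @ vs) = bar us + bar vs"
  by (simp add: words_of_inject[symmetric] plus_barword_def words_of_bar)

lemma words_of_add [simp]: "words_of (u + v) = words_of u @ words_of v"
  by (metis bar_append bar_words_of filter_append words_of_bar)

lemma bar_Nil [simp]: "bar [] = 0"
  by (simp add: zero_barword_def)

lemma bar_Cons: "bar (w # ws) = bar [w] + bar ws"
  using bar_append[of "[w]" ws] by simp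

lemma bar_empty_word [simp]: "bar ([] # ws) = bar ws"
  by (simp add: bar_def)

lemma form_ext_character:
  assumes "f 0 = 1" "\<And>u v. f (u + v) = f u * f v"
  shows "form_ext f \<in> characters"
  by (simp add: characters_def linear_form_form_ext form_ext_mult[OF assms(2)] assms(1))

text \<open>Empty entries of \<open>ws\<close> do no harm: \<open>bar\<close> deletes them, and the
  corresponding factor is the value 1 at the unit.\<close>

lemma character_basis_bar:
  assumes "\<mu> \<in> characters"
  shows "\<mu> (basis (bar ws)) = (\<Prod>w\<leftarrow>ws. \<mu> (basis (bar [w])))"
proof (induction ws)
  case (Cons w ws)
  then show ?case
    using assms by (subst bar_Cons) (simp add: basis_add characters_def)
qed (use assms in \<open>simp add: basis_0 characters_def\<close>)

lemma coeff_gen_series: "coeff (gen_series \<mu>) w = \<mu> (basis (bar [w]))"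
  by (simp add: gen_series_def basis_0)

text \<open>Barred words span and characters are multiplicative, so the values on single words
  decide. Identities between characters can thus be checked on generating series.\<close>

lemma characters_eqI:
  assumes \<mu>: "\<mu> \<in> characters" and \<nu>: "\<nu> \<in> characters" and eq: "gen_series \<mu> = gen_series \<nu>"
  shows "\<mu> = \<nu>"
proof
  fix p
  have "\<mu> (basis (bar [w])) = \<nu> (basis (bar [w]))" for w
    using eq by (metis coeff_gen_series)
  then have "\<mu> (basis u) = \<nu> (basis u)" for u
    using character_basis_bar[OF \<mu>, of "words_of u"] character_basis_bar[OF \<nu>, of "words_of u"]
    by (simp add: bar_words_of)
  then show "\<mu> p = \<nu> p"
    using linear_form_eq_form_ext[of \<mu> p] linear_form_eq_form_ext[of \<nu> p] \<mu> \<nu>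
    by (simp add: characters_def)
qed

text \<open>The map back from series to characters. The unit receives the empty product 1; the
  constant term is never read, since \<open>words_of u\<close> has only non-empty entries.\<close>

definition character_of :: "ncps \<Rightarrow> TV \<Rightarrow> complex" where
  "character_of f = form_ext (\<lambda>u. \<Prod>w\<leftarrow>words_of u. coeff f w)"

lemma character_of_in_characters: "character_of f \<in> characters"
  unfolding character_of_def by (rule form_ext_character) simp_all

lemma gen_series_character_of:
  assumes "coeff f [] = 1"
  shows "gen_series (character_of f) = f"
  by (rule ncps_eqI) (use assms in \<open>simp add: coeff_gen_series character_of_def words_of_bar\<close>)

lemma counit_eq: "counit = form_ext (\<lambda>u. if u = 0 then 1 else 0)"
proof
  fix p
  show "counit p = form_ext (\<lambda>u. if u = 0 then 1 else 0) p"
    by (cases "0 \<in> Poly_Mapping.keys p") (simp_all add: counit_def form_ext_def if_distrib in_keys_iff cong: if_cong)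
qed

lemma barword_eq_0_iff: "u = 0 \<longleftrightarrow> words_of u = []"
  by (simp add: words_of_inject[symmetric])

lemma counit_in_characters: "counit \<in> characters"
  unfolding counit_eq by (rule form_ext_character) (auto simp: barword_eq_0_iff)

lemma gen_series_counit: "gen_series counit = 1"
  by (rule ncps_eqI) (simp add: coeff_gen_series counit_eq barword_eq_0_iff words_of_bar)

section \<open>Tensor products of forms and convolution\<close>

lemma tensor_form_sum: "tensor_form \<mu> \<nu> (\<Sum>x\<in>A. g x) = (\<Sum>x\<in>A. tensor_form \<mu> \<nu> (g x))"
  by (simp add: tensor_form_def form_ext_sum)

lemma tensor_form_basis: "tensor_form \<mu> \<nu> (basis (u, v)) = \<mu> (basis u) * \<nu> (basis v)"
  by (simp add: tensor_form_def)

lemma tensor_form_mult: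
  assumes "\<mu> \<in> characters" "\<nu> \<in> characters"
  shows "tensor_form \<mu> \<nu> (p * q) = tensor_form \<mu> \<nu> p * tensor_form \<mu> \<nu> q"
  unfolding tensor_form_def
  by (rule form_ext_mult) (use assms in \<open>auto simp: characters_def basis_add\<close>)

lemma tensor_form_one:
  assumes "\<mu> \<in> characters" "\<nu> \<in> characters"
  shows "tensor_form \<mu> \<nu> 1 = 1"
  using assms by (simp add: tensor_form_def zero_prod_def basis_0 characters_def)

lemma conv_eq: "conv \<mu> \<nu> = form_ext (\<lambda>u. tensor_form \<mu> \<nu> (coprod_bar (words_of u)))"
  by (rule ext) (simp add: conv_def coprod_def tensor_form_def form_ext_lin_ext)

text \<open>The coproduct of a barred word is the product of the coproducts of its words, and the
  tensor product of two characters is multiplicative.\<close>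

lemma conv_in_characters:
  assumes "\<mu> \<in> characters" "\<nu> \<in> characters"
  shows "conv \<mu> \<nu> \<in> characters"
  unfolding conv_eq
  by (rule form_ext_character) (simp_all add: coprod_bar_def tensor_form_one tensor_form_mult assms)

lemma conv_word: "conv \<mu> \<nu> (basis (bar [w])) = tensor_form \<mu> \<nu> (coprod_word w)"
proof (cases "w = []")
  case True
  \<comment> \<open>The empty word is the unit, with the empty product as coproduct; this agrees
    with the only summand of \<open>coprod_word []\<close>.\<close>
  have "split_term [] {} = 1"
    using basis_0[where 'k = "barword \<times> barword"]
    by (simp add: split_term_def gap_list_empty zero_prod_def)
  then show ?thesis by (simp add: True conv_eq coprod_bar_def coprod_word_def)
qed (simp add: conv_eq words_of_bar coprod_bar_def)


section \<open>Generating series of convolutions and half-shuffles\<close>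

definition gap_bar :: "nat list \<Rightarrow> nat set \<Rightarrow> barword" where
  "gap_bar w S = bar (map (nths w) (gap_list (length w) S))"

lemma tensor_form_split_term:
  "tensor_form \<mu> \<nu> (split_term w S) = \<mu> (basis (bar [nths w S])) * \<nu> (basis (gap_bar w S))"
  by (simp add: split_term_def gap_bar_def tensor_form_basis)

lemma gap_bar_empty: "gap_bar w {} = bar [w]"
  by (simp add: gap_bar_def gap_list_empty)

lemma gap_bar_full: "gap_bar w {..<length w} = 0"
  by (simp add: gap_bar_def gap_list_full)

text \<open>Since \<open>bar\<close> deletes empty words, it must be checked that a gap gives a
  non-empty subword: its right endpoint is a position of \<open>w\<close>.\<close>

lemma gap_bar_eq_0:
  assumes "S \<subseteq> {..<length w}" "gap_bar w S = 0"
  shows "S = {..<length w}"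
proof (rule ccontr)
  assume "S \<noteq> {..<length w}"
  then have "gap_list (length w) S \<noteq> []"
    using assms(1) by (simp add: gap_list_eq_Nil_iff)
  then obtain J where J: "J \<in> set (gap_list (length w) S)"
    by (meson list.set_sel(1))
  then have "nths w J = []"
    using assms(2) by (auto simp: gap_bar_def barword_eq_0_iff words_of_bar filter_empty_conv)
  moreover obtain a b where "J = {a..b}" "a \<le> b" "b < length w"
    using J unfolding gap_list_props gaps_iff by blast
  then have "w ! b \<in> set (nths w J)" by (auto simp: set_nths)
  ultimately show False by simp
qed

text \<open>For \<open>k = 0\<close> the missing first gap is matched by
  \<open>bar [take 0 w] = 0\<close>, so no case distinction remains.\<close>

lemma gap_bar_prepend:
  assumes "k < length w" "T \<subseteq> {..<length w - Suc k}"
  shows "gap_bar w (prepend k T) = bar [take k w] + gap_bar (drop (Suc k) w) T"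
proof -
  have "map (nths w) (map ((`) ((+) (Suc k))) Js) = map (nths (drop (Suc k) w)) Js" for Js
    by (induction Js) (simp_all only: list.map nths_shift)
  moreover have "gap_list (length w) (prepend k T) =
      (if k = 0 then [] else [{..<k}]) @ map ((`) ((+) (Suc k))) (gap_list (length w - Suc k) T)"
    by (rule gap_list_prepend[OF assms])
  ultimately have "gap_bar w (prepend k T) = bar ((if k = 0 then [] else [take k w]) @
      map (nths (drop (Suc k) w)) (gap_list (length w - Suc k) T))"
    by (simp add: gap_bar_def del: map_map)
  then show ?thesis
    by (simp only: bar_append gap_bar_def length_drop) simp
qed

text \<open>The word is cut at its first selected position: the prefix is a gap, the letter
  \<open>w ! k\<close> passes into the derivative of \<open>f\<close>, and the same kind of sum
  remains for the suffix.\<close>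

lemma sum_subsets_left_deriv:
  assumes \<nu>: "\<nu> \<in> characters" and k: "k < length w"
  shows "(\<Sum>T\<in>Pow {..<length w - Suc k}. coeff f (nths w (prepend k T))
        * \<nu> (basis (gap_bar w (prepend k T))))
     = \<nu> (basis (bar [take k w])) * (\<Sum>T\<in>Pow {..<length (drop (Suc k) w)}.
        coeff (left_deriv (w ! k) f) (nths (drop (Suc k) w) T) * \<nu> (basis (gap_bar (drop (Suc k) w) T)))"
  unfolding sum_distrib_left
proof (rule sum.cong)
  fix T assume "T \<in> Pow {..<length (drop (Suc k) w)}"
  then show "coeff f (nths w (prepend k T)) * \<nu> (basis (gap_bar w (prepend k T)))
     = \<nu> (basis (bar [take k w])) *
       (coeff (left_deriv (w ! k) f) (nths (drop (Suc k) w) T) * \<nu> (basis (gap_bar (drop (Suc k) w) T)))"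
    using k \<nu> by (simp add: gap_bar_prepend nths_prepend basis_add characters_def)
qed simp

text \<open>Sorting the sets by their minimum \<open>k\<close> yields the Cauchy product defining
  \<open>\<star>\<close>, with the empty set as the split \<open>k = length w\<close>. The series
  \<open>f\<close> is arbitrary because the induction passes to its left derivatives.\<close>

lemma sum_subsets:
  assumes \<nu>: "\<nu> \<in> characters"
  shows "(\<Sum>S\<in>Pow {..<length w}. coeff f (nths w S) * \<nu> (basis (gap_bar w S)))
     = coeff (f \<star> gen_series \<nu>) w"
proof (induction w arbitrary: f rule: measure_induct_rule[of length])
  case (less w)
  let ?h = "gen_series \<nu>"
  have step: "(\<Sum>T\<in>Pow {..<length w - Suc k}. coeff f (nths w (prepend k T)) * \<nu> (basis (gap_bar w (prepend k T))))
     = \<nu> (basis (bar [take k w])) * coeff (ncps_subst f ?h) (drop k w)" if "k < length w" for k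
  proof -
    \<comment> \<open>Splitting off the first letter \<open>w ! k\<close> turns the substitution
      into a \<open>\<star>\<close> product at a shorter word.\<close>
    have "coeff (ncps_subst f ?h) (drop k w) = coeff (left_deriv (w ! k) f \<star> ?h) (drop (Suc k) w)"
      by (simp add: Cons_nth_drop_Suc[OF that, symmetric] char_mult_def left_deriv_subst[symmetric])
    moreover have "length (drop (Suc k) w) < length w" using that by simp
    ultimately show ?thesis
      by (simp only: sum_subsets_left_deriv[OF \<nu> that] less.IH)
  qed
  show ?case
    by (simp add: sum_Pow_by_Min[of _ "length w"] step gap_bar_empty
        char_mult_def coeff_times coeff_gen_series lessThan_Suc_atMost[symmetric])
qed

lemma gen_series_conv:
  assumes "\<nu> \<in> characters"
  shows "gen_series (conv \<mu> \<nu>) = gen_series \<mu> \<star> gen_series \<nu>"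
  by (rule ncps_eqI)
    (simp add: coeff_gen_series[of "conv \<mu> \<nu>"] conv_word coprod_word_def tensor_form_sum
      tensor_form_split_term coeff_gen_series[of \<mu>, symmetric] sum_subsets[OF assms])

section \<open>Half-coproducts and half-shuffles\<close>

lemma coprod_prec_word_eq:
  assumes "w \<noteq> []"
  shows "coprod_prec_word w = (\<Sum>S\<in>{S\<in>Pow {..<length w}. 0 \<in> S}. split_term w S)"
proof -
  \<comment> \<open>The separate summand of \<open>coprod_prec_word\<close> is the split term of the
    full set, which contains 0 because \<open>w\<close> is non-empty.\<close>
  have "{S\<in>Pow {..<length w}. 0 \<in> S} = insert {..<length w} {S. S \<subset> {..<length w} \<and> 0 \<in> S}"
    using assms by auto
  moreover have "finite {S. S \<subset> {..<length w} \<and> 0 \<in> S}"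
    by (rule finite_subset[of _ "Pow {..<length w}"]) auto
  ultimately show ?thesis
    by (simp add: coprod_prec_word_def split_term_def gap_list_full)
qed

lemma coprod_succ_word_eq:
  assumes "w \<noteq> []"
  shows "coprod_succ_word w = (\<Sum>S\<in>{S\<in>Pow {..<length w}. 0 \<notin> S}. split_term w S)"
proof -
  \<comment> \<open>Here the separate summand is the split term of the empty set, whose single gap
    is the whole word.\<close>
  have "{S\<in>Pow {..<length w}. 0 \<notin> S} = insert {} {S. S \<subset> {..<length w} \<and> 0 \<notin> S \<and> S \<noteq> {}}"
    using assms by auto
  moreover have "finite {S. S \<subset> {..<length w} \<and> 0 \<notin> S \<and> S \<noteq> {}}"
    by (rule finite_subset[of _ "Pow {..<length w}"]) auto
  ultimately show ?thesis
    using assms by (simp add: coprod_succ_word_def split_term_def gap_list_empty)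
qed

lemma half_prec_word:
  "w \<noteq> [] \<Longrightarrow> half_prec \<mu> \<nu> (basis (bar [w])) = tensor_form \<mu> \<nu> (coprod_prec_word w)"
  by (simp add: half_prec_def coprod_prec_def tensor_form_def form_ext_lin_ext words_of_bar coprod_bar_def)

lemma half_succ_word:
  "w \<noteq> [] \<Longrightarrow> half_succ \<mu> \<nu> (basis (bar [w])) = tensor_form \<mu> \<nu> (coprod_succ_word w)"
  by (simp add: half_succ_def coprod_succ_def tensor_form_def form_ext_lin_ext words_of_bar coprod_bar_def)

lemma half_prec_empty [simp]: "half_prec \<mu> \<nu> 1 = 0"
  by (simp add: half_prec_def coprod_prec_def tensor_form_def form_ext_lin_ext)

lemma half_succ_empty [simp]: "half_succ \<mu> \<nu> 1 = 0"
  by (simp add: half_succ_def coprod_succ_def tensor_form_def form_ext_lin_ext)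

text \<open>Only sets with minimum 0 remain, so the outer factor of the \<open>\<star>\<close>
  product disappears. The assumption \<open>\<mu> 1 = 0\<close> matches the constant terms.\<close>

lemma gen_series_half_prec:
  assumes \<nu>: "\<nu> \<in> characters" and \<mu>: "\<mu> 1 = 0"
  shows "gen_series (half_prec \<mu> \<nu>) = ncps_subst (gen_series \<mu>) (gen_series \<nu>)"
proof (rule ncps_eqI)
  fix w
  let ?f = "gen_series \<mu>" and ?h = "gen_series \<nu>"
  show "coeff (gen_series (half_prec \<mu> \<nu>)) w = coeff (ncps_subst ?f ?h) w"
  proof (cases w)
    case Nil
    then show ?thesis using \<mu> by (simp add: coeff_gen_series basis_0)
  next
    case (Cons i v)
    let ?g = "\<lambda>S. coeff ?f (nths w S) * \<nu> (basis (gap_bar w S))"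
    have "coeff (gen_series (half_prec \<mu> \<nu>)) w = (\<Sum>S\<in>{S\<in>Pow {..<length w}. 0 \<in> S}. ?g S)"
      using Cons by (simp add: coeff_gen_series half_prec_word coprod_prec_word_eq tensor_form_sum
          tensor_form_split_term)
    also have "\<dots> = (\<Sum>S\<in>Pow {..<length w}. if 0 \<in> S then ?g S else 0)"
      by (rule sum.inter_filter) simp
    also have "\<dots> = (\<Sum>k<length w. \<Sum>T\<in>Pow {..<length w - Suc k}.
        if k = 0 then ?g (prepend k T) else 0)"
      by (subst sum_Pow_by_Min) (auto intro!: sum.cong)
    also have "\<dots> = (\<Sum>k\<in>{0}. \<Sum>T\<in>Pow {..<length w - Suc k}. ?g (prepend k T))"
      by (rule sum.mono_neutral_cong_right) (use Cons in auto)
    \<comment> \<open>The first gap is empty and contributes the value 1 of \<open>\<nu>\<close> at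
      the unit.\<close>
    also have "\<dots> = coeff (left_deriv i ?f \<star> ?h) v"
      using sum_subsets_left_deriv[OF \<nu>, of 0 w ?f] sum_subsets[OF \<nu>, of "left_deriv i ?f" v] Cons \<nu>
      by (simp add: characters_def basis_0)
    also have "\<dots> = coeff (ncps_subst ?f ?h) w"
      by (simp add: Cons char_mult_def left_deriv_subst[symmetric])
    finally show ?thesis .
  qed
qed

text \<open>A surviving set leaves only an initial gap, so the word splits into a prefix read by
  \<open>\<nu>\<close> and a suffix read by \<open>\<mu>\<close>, as in a Cauchy product.\<close>

lemma gen_series_half_succ:
  assumes \<mu>: "\<mu> 1 = 1" and \<nu>: "\<nu> \<in> inf_characters"
  shows "gen_series (half_succ \<mu> \<nu>) = gen_series \<nu> * gen_series \<mu>"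
proof (rule ncps_eqI)
  fix w
  let ?f = "gen_series \<mu>" and ?h = "gen_series \<nu>"
  have \<nu>1: "\<nu> 1 = 0" and bars: "2 \<le> length (words_of u) \<Longrightarrow> \<nu> (basis u) = 0" for u
    using \<nu> by (auto simp: inf_characters_def basis_def)
  show "coeff (gen_series (half_succ \<mu> \<nu>)) w = coeff (?h * ?f) w"
  proof (cases w)
    case Nil
    then show ?thesis using \<nu>1 by (simp add: coeff_gen_series basis_0)
  next
    case (Cons i v)
    let ?g = "\<lambda>S. coeff ?f (nths w S) * \<nu> (basis (gap_bar w S))"
    have inner: "(\<Sum>T\<in>Pow {..<length w - Suc k}. ?g (prepend k T))
        = coeff ?h (take k w) * coeff ?f (drop k w)" if k: "0 < k" "k < length w" for k
    proof -
      let ?u = "drop (Suc k) w"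
      have "(\<Sum>T\<in>Pow {..<length w - Suc k}. ?g (prepend k T))
          = (\<Sum>T\<in>{{..<length ?u}}. ?g (prepend k T))"
      proof (rule sum.mono_neutral_right)
        show "\<forall>T\<in>Pow {..<length w - Suc k} - {{..<length ?u}}. ?g (prepend k T) = 0"
        proof
          fix T assume T: "T \<in> Pow {..<length w - Suc k} - {{..<length ?u}}"
          then have "gap_bar ?u T \<noteq> 0" using gap_bar_eq_0[of T ?u] by auto
          then have "words_of (gap_bar ?u T) \<noteq> []" by (simp add: barword_eq_0_iff)
          \<comment> \<open>The prefix before \<open>k > 0\<close> is one non-empty factor, and the
            gaps after \<open>k\<close> give at least one more.\<close>
          then have "2 \<le> length (words_of (gap_bar w (prepend k T)))"
            using T k by (cases "words_of (gap_bar ?u T)") (auto simp: gap_bar_prepend words_of_bar)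
          from bars[OF this] show "?g (prepend k T) = 0" by simp
        qed
      qed auto
      also have "\<dots> = coeff ?f (w ! k # ?u) * \<nu> (basis (bar [take k w]))"
        using k gap_bar_full[of ?u]
        by (simp add: gap_bar_prepend nths_prepend)
      finally show ?thesis
        using k by (simp add: Cons_nth_drop_Suc coeff_gen_series[of \<nu>])
    qed
    have "coeff (gen_series (half_succ \<mu> \<nu>)) w = (\<Sum>S\<in>{S\<in>Pow {..<length w}. 0 \<notin> S}. ?g S)"
      using Cons by (simp add: coeff_gen_series half_succ_word coprod_succ_word_eq tensor_form_sum
          tensor_form_split_term)
    also have "\<dots> = (\<Sum>S\<in>Pow {..<length w}. if 0 \<notin> S then ?g S else 0)"
      by (rule sum.inter_filter) simp
    also have "\<dots> = ?g {} + (\<Sum>k<length w. \<Sum>T\<in>Pow {..<length w - Suc k}.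
        if k \<noteq> 0 then ?g (prepend k T) else 0)"
      by (subst sum_Pow_by_Min) (auto intro!: sum.cong)
    also have "(\<Sum>k<length w. \<Sum>T\<in>Pow {..<length w - Suc k}.
        if k \<noteq> 0 then ?g (prepend k T) else 0)
      = (\<Sum>k<length w. coeff ?h (take k w) * coeff ?f (drop k w))"
    proof (rule sum.cong)
      fix k assume "k \<in> {..<length w}"
      \<comment> \<open>For \<open>k = 0\<close> the left side is excluded by
        \<open>0 \<notin> S\<close>, and the right side vanishes because
        \<open>\<nu> 1 = 0\<close>.\<close>
      then show "(\<Sum>T\<in>Pow {..<length w - Suc k}. if k \<noteq> 0 then ?g (prepend k T) else 0)
          = coeff ?h (take k w) * coeff ?f (drop k w)"
        using inner[of k] \<nu>1 by (cases "k = 0") (simp_all add: coeff_gen_series[of \<nu>] basis_0)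
    qed simp
    also have "?g {} = coeff ?h w * coeff ?f []"
      using \<mu> by (simp add: gap_bar_empty coeff_gen_series basis_0)
    finally show ?thesis
      by (simp add: coeff_times lessThan_Suc_atMost[symmetric])
  qed
qed

text \<open>Associativity is pulled back from \<open>\<star>\<close> along the generating series,
  which determines a character. The monoid structure suffices to identify an explicitly given
  inverse.\<close>

lemma monoid_char_group: "monoid char_group"
proof (rule monoidI)
  fix \<mu> \<nu> \<rho>
  assume "\<mu> \<in> carrier char_group" "\<nu> \<in> carrier char_group" "\<rho> \<in> carrier char_group"
  then have c: "\<mu> \<in> characters" "\<nu> \<in> characters" "\<rho> \<in> characters"
    by (simp_all add: char_group_def)
  show "\<mu> \<otimes>\<^bsub>char_group\<^esub> \<nu> \<otimes>\<^bsub>char_group\<^esub> \<rho> = \<mu> \<otimes>\<^bsub>char_group\<^esub> (\<nu> \<otimes>\<^bsub>char_group\<^esub> \<rho>)"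
    by (auto intro!: characters_eqI conv_in_characters
        simp: char_group_def gen_series_conv conv_in_characters c char_mult_assoc)
qed (auto intro!: characters_eqI conv_in_characters counit_in_characters
    simp: char_group_def gen_series_conv counit_in_characters gen_series_counit)

lemma moment_character_in_characters:
  "moment_character \<phi> b \<in> characters"
  unfolding moment_character_def by (rule form_ext_character) simp_all

lemma gen_series_counit_add: "gen_series (\<lambda>p. counit p + \<mu> p) = 1 + gen_series \<mu>"
  by (rule ncps_eqI) (simp add: coeff_gen_series flip: gen_series_counit)

theorem proposition6p3:
  fixes scale :: "complex \<Rightarrow> 'b::ring_1 \<Rightarrow> 'b"
    and \<phi> :: "'b \<Rightarrow> complex"
    and b :: "nat \<Rightarrow> 'b"
    and \<Phi> \<kappa> \<beta> :: "TV \<Rightarrow> complex"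
  assumes prob: "nc_prob_space scale \<phi>"
    and "\<Phi> = moment_character \<phi> b"
    and "\<kappa> \<in> inf_characters"
    and "\<Phi> = (\<lambda>p. counit p + half_prec \<kappa> \<Phi> p)"
    and "\<beta> \<in> inf_characters"
    and "\<Phi> = (\<lambda>p. counit p + half_succ \<Phi> \<beta> p)"
  shows "gen_series (inv\<^bsub>char_group\<^esub> \<Phi>) = ncps_inverse (1 + gen_series \<kappa>)
    \<and> gen_series \<beta> = 1 - ncps_subst (gen_series (inv\<^bsub>char_group\<^esub> \<Phi>)) (gen_series \<Phi>)"
proof -
  let ?P = "gen_series \<Phi>" and ?K = "1 + gen_series \<kappa>"
  \<comment> \<open>The series predicted for the inverse; \<open>\<Psi>\<close> is the character
    that it defines.\<close>
  define Q where "Q = ncps_inverse ?K"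
  define \<Psi> where "\<Psi> = character_of Q"
  have \<Phi>: "\<Phi> \<in> characters"
    using assms(2) by (simp add: moment_character_in_characters)
  have "\<kappa> 1 = 0" using assms(3) by (simp add: inf_characters_def)
  then have Q: "?K * Q = 1" "coeff Q [] = 1"
    using ncps_inverse_props[of ?K] by (simp_all add: Q_def coeff_gen_series basis_0)
  have \<Psi>: "\<Psi> \<in> characters" and gen_\<Psi>: "gen_series \<Psi> = Q"
    using Q(2) by (simp_all add: \<Psi>_def character_of_in_characters gen_series_character_of)
  have P_eq: "?P = ncps_subst ?K ?P"
    by (subst assms(4)) (simp add: gen_series_counit_add gen_series_half_prec \<Phi> \<open>\<kappa> 1 = 0\<close> subst_add)
  \<comment> \<open>Only the left factor is rewritten by \<open>P_eq\<close>, whose right side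
    contains \<open>?P\<close> again. Multiplicativity of substitution then brings
    \<open>?K * Q\<close> together.\<close>
  have "Q \<star> ?P = ncps_subst ?K ?P * ncps_subst Q ?P"
    unfolding char_mult_def by (rule arg_cong2[of _ _ _ _ "(*)", OF P_eq refl])
  then have QP: "Q \<star> ?P = 1"
    by (simp only: subst_mult[symmetric] Q(1) subst_1)
  \<comment> \<open>A left inverse becomes two-sided by reassociating and cancelling
    \<open>Q\<close> on the left.\<close>
  have "Q \<star> (?P \<star> Q) = Q \<star> 1"
    using QP by (simp flip: char_mult_assoc)
  then have PQ: "?P \<star> Q = 1"
    by (rule char_mult_left_cancel[OF Q(2)])
  have "inv\<^bsub>char_group\<^esub> \<Phi> = \<Psi>"
  proof (rule monoid.inv_unique'[OF monoid_char_group, symmetric])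
    show "\<Phi> \<otimes>\<^bsub>char_group\<^esub> \<Psi> = \<one>\<^bsub>char_group\<^esub>" "\<Psi> \<otimes>\<^bsub>char_group\<^esub> \<Phi> = \<one>\<^bsub>char_group\<^esub>"
      using QP PQ \<Phi> \<Psi>
      by (auto intro!: characters_eqI conv_in_characters counit_in_characters
          simp: char_group_def gen_series_conv gen_\<Psi> gen_series_counit)
  qed (use \<Phi> \<Psi> in \<open>simp_all add: char_group_def\<close>)
  then have inv: "gen_series (inv\<^bsub>char_group\<^esub> \<Phi>) = Q"
    by (simp add: gen_\<Psi>)
  have "\<Phi> 1 = 1" using \<Phi> by (simp add: characters_def)
  then have "?P = 1 + gen_series \<beta> * ?P"
    by (subst assms(6)) (simp add: gen_series_counit_add gen_series_half_succ assms(5))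
  then have "(1 - gen_series \<beta>) * ?P = 1"
    by (simp add: algebra_simps)
  \<comment> \<open>By \<open>QP\<close> the substituted series is a right inverse of
    \<open>?P\<close>, and \<open>1 - gen_series \<beta>\<close> is a left inverse, so they
    coincide.\<close>
  then have "1 - gen_series \<beta> = ncps_subst Q ?P"
    using QP unfolding char_mult_def by (metis mult.assoc mult.left_neutral mult.right_neutral)
  then show ?thesis
    using inv by (simp add: Q_def algebra_simps)
qed

end
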